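(* Let $G$ and $H$ be graphs with $\delta(H)\ge 2$, and let $\vec H$ be an anti-directed orientation of $H$. If $m(G)<\delta(H)-1/2$, then $G\not\to\vec H$, i.e., $G$ has an orientation containing no copy of $\vec H$.
   Context: An oriented graph is anti-directed if each vertex has either no in-neighbours or no out-neighbours. $m(G)=\max\{e(J)/v(J):J\subseteq G,\ v(J)\ge1\}$. $\delta(H)$ is the minimum degree of $H$. *)

theory Defs
  imports Complex_Main "Graph_Theory.Graph_Theory"
begin

text \<open>
  Finite simple graphs are represented, as in the AFP entry \<open>Graph_Theory\<close>, by finite loopfree
  symmetric digraphs (locale \<^locale>\<open>pair_graph\<close>): an edge \<open>uv\<close> is the pair of arcs \<open>(u, v)\<close>
  and \<open>(v, u)\<close>. Oriented graphs live in the same record type, so no arc of an oriented graph may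
  occur together with its reverse.
\<close>

definition edge_set :: "'a pair_pre_digraph \<Rightarrow> 'a set set" where
  "edge_set G = {{u, v} | u v. (u, v) \<in> parcs G}"

text \<open>
  In a symmetric digraph the out-degree of a vertex is its degree in the undirected graph.
  The null graph gets minimum degree 0 and density 0.
\<close>

definition min_degree :: "'a pair_pre_digraph \<Rightarrow> nat" where
  "min_degree G =
     (if pverts G = {} then 0 else Min {out_degree (with_proj G) v | v. v \<in> pverts G})"

definition max_density :: "'a pair_pre_digraph \<Rightarrow> real" where
  "max_density G =
     (if pverts G = {} then 0
      else Max {real (card (edge_set J)) / real (card (pverts J)) | J.
             pair_graph J \<and> subgraph (with_proj J) (with_proj G) \<and> card (pverts J) \<ge> 1})"

definition oriented_graph :: "'a pair_pre_digraph \<Rightarrow> bool" where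
  "oriented_graph D \<longleftrightarrow>
     pair_digraph D \<and> (\<forall>u v. (u, v) \<in> parcs D \<longrightarrow> (v, u) \<notin> parcs D)"

definition orientation_of :: "'a pair_pre_digraph \<Rightarrow> 'a pair_pre_digraph \<Rightarrow> bool" where
  "orientation_of D G \<longleftrightarrow> oriented_graph D \<and> mk_symmetric (with_proj D) = G"

definition anti_directed :: "'a pair_pre_digraph \<Rightarrow> bool" where
  "anti_directed D \<longleftrightarrow>
     (\<forall>v \<in> pverts D. {u. (u, v) \<in> parcs D} = {} \<or> {w. (v, w) \<in> parcs D} = {})"

definition contains_copy :: "'a pair_pre_digraph \<Rightarrow> 'b pair_pre_digraph \<Rightarrow> bool" where
  "contains_copy D F \<longleftrightarrow>
     (\<exists>J. subgraph (with_proj J) (with_proj D) \<and> digraph_iso (with_proj F) (with_proj J))"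

definition arrows :: "'a pair_pre_digraph \<Rightarrow> 'b pair_pre_digraph \<Rightarrow> bool" where
  "arrows G F \<longleftrightarrow> (\<forall>D. orientation_of D G \<longrightarrow> contains_copy D F)"

end

theory Submission
  imports Defs
begin

text \<open>
  Put \<open>k = \<delta>(H) - 1\<close>. Every nonempty subgraph of \<open>G\<close> has average degree below \<open>2k + 1\<close>, so \<open>G\<close> is
  \<open>2k\<close>-degenerate: its vertices can be ordered such that each has at most \<open>2k\<close> earlier neighbours.
  Orient at most \<open>k\<close> of these edges out of the vertex and at most \<open>k\<close> into it. The last vertex of
  a copy of an anti-directed orientation of \<open>H\<close> would have at least \<open>k + 1\<close> earlier neighbours, all
  joined to it in the same direction.
\<close>

section \<open>Balanced orientations of degenerate graphs\<close>

lemma split_set_card_le: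
  assumes "finite N" and "card N \<le> 2 * k"
  obtains A B where "N = A \<union> B" and "A \<inter> B = {}" and "card A \<le> k" and "card B \<le> k"
proof -
  obtain A where A: "A \<subseteq> N" "card A = min k (card N)"
    by (meson min.cobounded2 obtain_subset_with_card_n)
  have "card (N - A) = card N - card A"
    using A assms(1) by (meson card_Diff_subset finite_subset)
  then have "card (N - A) \<le> k"
    using A(2) assms(2) by linarith
  then show thesis
    using that[of A "N - A"] A by auto
qed

text \<open>
  Degeneracy is expressed without an ordering: every nonempty vertex set \<open>W\<close> has a vertex of small
  degree within \<open>W\<close>.
\<close>

lemma balanced_orientation_exists:
  assumes "finite V" and "sym E" and "irrefl E"
    and "\<forall>W. W \<subseteq> V \<longrightarrow> W \<noteq> {} \<longrightarrow> (\<exists>v\<in>W. card {u \<in> W. (v, u) \<in> E} \<le> 2 * k)"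
  shows "\<exists>R. R \<inter> R\<inverse> = {} \<and> R \<union> R\<inverse> = E \<inter> V \<times> V \<and>
    (\<forall>W. W \<subseteq> V \<longrightarrow> W \<noteq> {} \<longrightarrow>
      (\<exists>v\<in>W. card {u \<in> W. (v, u) \<in> R} \<le> k \<and> card {u \<in> W. (u, v) \<in> R} \<le> k))"
  using assms(1,4)
proof (induction V rule: finite_psubset_induct)
  case (psubset V)
  show ?case
  proof (cases "V = {}")
    case True
    then show ?thesis by (intro exI[of _ "{}"]) auto
  next
    case False
    \<comment> \<open>The degeneracy condition with \<open>W = V\<close> provides the last vertex
      \<open>v\<close> of the ordering. The condition is inherited by subsets, so the induction
      hypothesis orients the edges within \<open>V - {v}\<close>.\<close>
    then obtain v where v: "v \<in> V" "card {u \<in> V. (v, u) \<in> E} \<le> 2 * k"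
      using psubset.prems by auto
    have small: "\<forall>W. W \<subseteq> V - {v} \<longrightarrow> W \<noteq> {} \<longrightarrow>
        (\<exists>w\<in>W. card {u \<in> W. (w, u) \<in> E} \<le> 2 * k)"
      using psubset.prems by blast
    have "V - {v} \<subset> V"
      using v(1) by blast
    from psubset.IH[OF this small] obtain R where
      R: "R \<inter> R\<inverse> = {}" "R \<union> R\<inverse> = E \<inter> (V - {v}) \<times> (V - {v})"
      and deg: "\<forall>W. W \<subseteq> V - {v} \<longrightarrow> W \<noteq> {} \<longrightarrow>
        (\<exists>v\<in>W. card {u \<in> W. (v, u) \<in> R} \<le> k \<and> card {u \<in> W. (u, v) \<in> R} \<le> k)"
      by (elim exE conjE) (rule that)
    obtain A B where AB: "{u \<in> V. (v, u) \<in> E} = A \<union> B" "A \<inter> B = {}" "card A \<le> k" "card B \<le> k"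
      using split_set_card_le[OF _ v(2)] psubset.hyps by auto
    have fin: "finite A" "finite B"
      using finite_subset[OF _ psubset.hyps] AB(1) by blast+
    have vE: "(v, v) \<notin> E"
      using assms(3) by (simp add: irrefl_def)
    then have vAB: "v \<notin> A" "v \<notin> B"
      using AB(1) by auto
    have RV: "a \<in> V - {v} \<and> b \<in> V - {v}" if "(a, b) \<in> R" for a b
      using R(2) that by blast
    \<comment> \<open>The new vertex \<open>v\<close> sends arcs to one half of its earlier
      neighbours and receives arcs from the other half; all older arcs stay as they are.\<close>
    define S where "S = R \<union> {v} \<times> A \<union> B \<times> {v}"
    have "S \<inter> S\<inverse> = {}"
      using R(1) AB(2) vAB RV unfolding S_def by blast
    moreover have "S \<union> S\<inverse> = E \<inter> V \<times> V"
    proof -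
      have "S \<union> S\<inverse> = (R \<union> R\<inverse>) \<union> {v} \<times> (A \<union> B) \<union> (A \<union> B) \<times> {v}"
        unfolding S_def by blast
      also have "\<dots> = E \<inter> V \<times> V"
        unfolding R(2) AB(1)[symmetric] using v(1) vE symD[OF assms(2)] by blast
      finally show ?thesis .
    qed
    moreover have "\<exists>w\<in>W. card {u \<in> W. (w, u) \<in> S} \<le> k \<and> card {u \<in> W. (u, w) \<in> S} \<le> k"
      if W: "W \<subseteq> V" "W \<noteq> {}" for W
    \<comment> \<open>If \<open>v\<close> is in \<open>W\<close>, it is itself the witness, since
      \<open>R\<close> does not meet \<open>v\<close>. Otherwise \<open>S\<close> and
      \<open>R\<close> agree within \<open>W\<close>, and the witness for \<open>R\<close> still
      serves.\<close>
    proof (cases "v \<in> W")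
      case True
      have "{u \<in> W. (v, u) \<in> S} \<subseteq> A" "{u \<in> W. (u, v) \<in> S} \<subseteq> B"
        using RV vAB unfolding S_def by blast+
      then show ?thesis
        using True AB(3,4) fin by (meson card_mono le_trans)
    next
      case False
      then have "{u \<in> W. (w, u) \<in> S} = {u \<in> W. (w, u) \<in> R}"
        "{u \<in> W. (u, w) \<in> S} = {u \<in> W. (u, w) \<in> R}" if "w \<in> W" for w
        using that unfolding S_def by blast+
      then show ?thesis
        using deg[rule_format, of W] W False by (simp add: subset_Diff_insert)
    qed
    ultimately show ?thesis by blast
  qed
qed

section \<open>From low density to degeneracy\<close>

text \<open>Only the arcs \<open>(u, v)\<close> and \<open>(v, u)\<close> lie over the edge
  \<open>{u, v}\<close>. This turns degree sums, which count arcs, into bounds on the number of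
  edges.\<close>

lemma card_parcs_le_edge_set:
  assumes "finite (parcs J)"
  shows "card (parcs J) \<le> 2 * card (edge_set J)"
proof -
  have edges: "edge_set J = (\<lambda>(u, v). {u, v}) ` parcs J"
    unfolding edge_set_def by auto
  then have fin: "finite (edge_set J)"
    using assms by simp
  have "card {a \<in> parcs J. {fst a, snd a} = e} \<le> 2" if e_in: "e \<in> edge_set J" for e
  proof -
    obtain u v where e: "e = {u, v}"
      using e_in unfolding edge_set_def by blast
    have "{a \<in> parcs J. {fst a, snd a} = e} \<subseteq> {(u, v), (v, u)}"
      unfolding e by (auto simp: doubleton_eq_iff)
    then have "card {a \<in> parcs J. {fst a, snd a} = e} \<le> card {(u, v), (v, u)}"
      by (intro card_mono) auto
    also have "\<dots> \<le> 2"
      by (rule card_insert_le_m1) auto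
    finally show ?thesis .
  qed
  then have "(\<Sum>e\<in>edge_set J. card {a \<in> parcs J. {fst a, snd a} = e}) \<le> card (edge_set J) * 2"
    using sum_bounded_above[of "edge_set J" "\<lambda>e. card {a \<in> parcs J. {fst a, snd a} = e}" 2] by simp
  moreover have "(\<Union>e\<in>edge_set J. {a \<in> parcs J. {fst a, snd a} = e}) = parcs J"
    unfolding edges by auto
  then have "card (parcs J) \<le> (\<Sum>e\<in>edge_set J. card {a \<in> parcs J. {fst a, snd a} = e})"
    using card_UN_le[OF fin, of "\<lambda>e. {a \<in> parcs J. {fst a, snd a} = e}"] by simp
  ultimately show ?thesis by linarith
qed

text \<open>The point is that the maximum ranges over a finite set: the density of a subgraph
  depends only on its vertex and arc sets, which are subsets of two finite sets.\<close>

lemma density_le_max_density: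
  assumes "pair_graph G" and "pair_graph J" and "subgraph (with_proj J) (with_proj G)"
    and "pverts J \<noteq> {}"
  shows "real (card (edge_set J)) / real (card (pverts J)) \<le> max_density G"
proof -
  interpret G: pair_graph G by fact
  interpret J: pair_graph J by fact
  let ?D = "{real (card (edge_set J)) / real (card (pverts J)) | J.
    pair_graph J \<and> subgraph (with_proj J) (with_proj G) \<and> card (pverts J) \<ge> 1}"
  have "?D \<subseteq> (\<lambda>(W, A). real (card (edge_set \<lparr>pverts = W, parcs = A\<rparr>)) / real (card W)) `
    (Pow (pverts G) \<times> Pow (parcs G))"
  proof
    fix x assume "x \<in> ?D"
    then obtain J where "x = real (card (edge_set J)) / real (card (pverts J))"
      and "pverts J \<subseteq> pverts G" "parcs J \<subseteq> parcs G"
      by (auto simp: subgraph_def)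
    then show "x \<in> (\<lambda>(W, A). real (card (edge_set \<lparr>pverts = W, parcs = A\<rparr>)) / real (card W)) `
      (Pow (pverts G) \<times> Pow (parcs G))"
      by (intro image_eqI[of _ _ "(pverts J, parcs J)"]) (auto simp: edge_set_def)
  qed
  then have "finite ?D"
    by (rule finite_subset) (simp add: G.pair_finite_verts G.pair_finite_arcs)
  moreover have "card (pverts J) \<ge> 1"
    using assms(4) J.pair_finite_verts by (simp add: Suc_le_eq card_gt_0_iff)
  then have "real (card (edge_set J)) / real (card (pverts J)) \<in> ?D"
    using assms(2,3) by blast
  ultimately have "real (card (edge_set J)) / real (card (pverts J)) \<le> Max ?D"
    by (rule Max_ge)
  \<comment> \<open>This excludes the default value 0 in \<open>max_density\<close>.\<close>
  moreover have "pverts G \<noteq> {}"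
    using assms(3,4) by (auto simp: subgraph_def)
  ultimately show ?thesis
    unfolding max_density_def by simp
qed

text \<open>If all degrees within \<open>W\<close> were at least \<open>2 * k + 1\<close>, then the
  subgraph induced on \<open>W\<close> would have at least \<open>(2 * k + 1) * card W / 2\<close>
  edges, hence density at least \<open>k + 1 / 2\<close>.\<close>

lemma max_density_imp_small_degree:
  assumes "pair_graph G" and "max_density G < real k + 1 / 2"
    and "W \<subseteq> pverts G" and "W \<noteq> {}"
  shows "\<exists>v\<in>W. card {u \<in> W. (v, u) \<in> parcs G} \<le> 2 * k"
proof (rule ccontr)
  assume "\<not> ?thesis"
  then have large: "2 * k + 1 \<le> card {u \<in> W. (v, u) \<in> parcs G}" if "v \<in> W" for v
    using that by (metis Suc_eq_plus1 not_less_eq_eq)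
  interpret G: pair_graph G by fact
  have finW: "finite W"
    using assms(3) G.pair_finite_verts finite_subset by blast
  define J where "J = \<lparr>pverts = W, parcs = parcs G \<inter> W \<times> W\<rparr>"
  have sym: "sym (parcs G)"
    using G.pair_sym_arcs by (simp add: symmetric_def)
  have J: "pair_graph J"
  proof
    show "symmetric (with_proj J)"
      using sym by (auto simp: symmetric_def J_def sym_def)
  qed (auto simp: J_def finW G.pair_finite_arcs dest: G.no_loops')
  then interpret J: pair_graph J .
  have sub: "subgraph (with_proj J) (with_proj G)"
    using assms(3) G.wf_digraph_axioms J.wf_digraph_axioms
    by (auto simp: subgraph_def J_def compatible_def)
  \<comment> \<open>Grouping the arcs of the induced subgraph by their tails gives the degree
    sum.\<close>
  have "parcs J = (SIGMA v:W. {u \<in> W. (v, u) \<in> parcs G})"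
    by (auto simp: J_def)
  then have "card (parcs J) = (\<Sum>v\<in>W. card {u \<in> W. (v, u) \<in> parcs G})"
    using finW by simp
  also have "\<dots> \<ge> (2 * k + 1) * card W"
    using sum_bounded_below[of W "2 * k + 1"] large by (simp add: mult.commute)
  finally have "(2 * k + 1) * card W \<le> 2 * card (edge_set J)"
    using card_parcs_le_edge_set[OF J.pair_finite_arcs] by linarith
  then have "(2 * real k + 1) * real (card W) \<le> 2 * real (card (edge_set J))"
    by (metis (mono_tags, lifting) of_nat_1 of_nat_add of_nat_le_iff of_nat_mult of_nat_numeral)
  moreover have "card W > 0"
    using finW assms(4) by (simp add: card_gt_0_iff)
  ultimately have "real k + 1 / 2 \<le> real (card (edge_set J)) / real (card W)"
    by (simp add: field_simps)
  also have "\<dots> \<le> max_density G"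
    using density_le_max_density[OF assms(1) J sub] assms(4) by (simp add: J_def)
  finally show False
    using assms(2) by linarith
qed

section \<open>Copies and vertex degrees\<close>

text \<open>Reduces a copy to an injective homomorphism, namely the vertex map of the isomorphism
  onto a subgraph.\<close>

lemma contains_copyE:
  assumes "contains_copy D F"
  obtains f where "inj_on f (pverts F)" and "f ` pverts F \<subseteq> pverts D"
    and "\<And>x y. (x, y) \<in> parcs F \<Longrightarrow> (f x, f y) \<in> parcs D"
proof -
  obtain J h where sub: "subgraph (with_proj J) (with_proj D)"
    and h: "pre_digraph.digraph_isomorphism (with_proj F) h"
    and J: "with_proj J = app_iso h (with_proj F)"
    using assms unfolding contains_copy_def digraph_iso_def by blast
  \<comment> \<open>An isomorphism maps vertices and arcs separately and prescribes new tail and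
    head maps. Here these must be \<open>fst\<close> and \<open>snd\<close>, so the vertex map
    determines the image of each arc.\<close>
  have verts: "pverts J = iso_verts h ` pverts F" and arcs: "parcs J = iso_arcs h ` parcs F"
    and tail: "iso_tail h = fst" and head: "iso_head h = snd"
    using arg_cong[OF J, of verts] arg_cong[OF J, of arcs]
      arg_cong[OF J, of tail] arg_cong[OF J, of head] by simp_all
  show thesis
  proof
    show "inj_on (iso_verts h) (pverts F)"
      using h by (simp add: pre_digraph.digraph_isomorphism_def)
    show "iso_verts h ` pverts F \<subseteq> pverts D"
      using sub verts by (simp add: subgraph_def)
    fix x y assume xy: "(x, y) \<in> parcs F"
    then have "iso_arcs h (x, y) = (iso_verts h x, iso_verts h y)"
      using h tail head by (force simp: pre_digraph.digraph_isomorphism_def prod_eq_iff)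
    then show "(iso_verts h x, iso_verts h y) \<in> parcs D"
      using xy arcs sub by (auto simp: subgraph_def)
  qed
qed

lemma min_degree_le_card_neighbours:
  assumes "finite (pverts H)" and "v \<in> pverts H"
  shows "min_degree H \<le> card {w. (v, w) \<in> parcs H}"
proof -
  have "min_degree H \<le> out_degree (with_proj H) v"
    using assms unfolding min_degree_def by (auto intro!: Min_le)
  also have "out_arcs (with_proj H) v = Pair v ` {w. (v, w) \<in> parcs H}"
    by (auto simp: out_arcs_def)
  then have "out_degree (with_proj H) v = card {w. (v, w) \<in> parcs H}"
    unfolding out_degree_def by (simp add: card_image inj_on_def)
  finally show ?thesis .
qed

lemma parcs_mk_symmetric_with_proj: "parcs (mk_symmetric (with_proj D)) = parcs D \<union> (parcs D)\<inverse>"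
  by (auto simp: parcs_mk_symmetric)

section \<open>An orientation of the host graph without a copy\<close>

theorem theorem13:
  fixes G :: "'a pair_pre_digraph" and H Hvec :: "'b pair_pre_digraph"
  assumes "pair_graph G" and "pair_graph H"
    and "min_degree H \<ge> 2"
    and "orientation_of Hvec H" and "anti_directed Hvec"
    and "max_density G < real (min_degree H) - 1 / 2"
  shows "\<not> arrows G Hvec"
proof
  assume arrows: "arrows G Hvec"
  interpret G: pair_graph G by fact
  interpret H: pair_graph H by fact
  \<comment> \<open>With this choice the density bound reads \<open>k + 1 / 2\<close>, the threshold
    for degeneracy \<open>2 * k\<close>. The natural subtraction is exact because the minimum degree
    is positive.\<close>
  define k where "k = min_degree H - 1"
  have k: "min_degree H = k + 1"
    using assms(3) unfolding k_def by simp
  have sym: "sym (parcs G)"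
    using G.pair_sym_arcs by (simp add: symmetric_def)
  have irrefl: "irrefl (parcs G)"
    using G.no_loops' by (auto simp: irrefl_def)
  have density: "max_density G < real k + 1 / 2"
    using assms(6) k by simp
  have "\<forall>W. W \<subseteq> pverts G \<longrightarrow> W \<noteq> {} \<longrightarrow>
      (\<exists>v\<in>W. card {u \<in> W. (v, u) \<in> parcs G} \<le> 2 * k)"
    by (intro allI impI max_density_imp_small_degree[OF assms(1) density])
  from balanced_orientation_exists[OF G.pair_finite_verts sym irrefl this]
  obtain R where R: "R \<inter> R\<inverse> = {}" "R \<union> R\<inverse> = parcs G \<inter> pverts G \<times> pverts G"
    and deg: "\<forall>W. W \<subseteq> pverts G \<longrightarrow> W \<noteq> {} \<longrightarrow>
      (\<exists>v\<in>W. card {u \<in> W. (v, u) \<in> R} \<le> k \<and> card {u \<in> W. (u, v) \<in> R} \<le> k)"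
    by (elim exE conjE) (rule that)
  have RG: "R \<union> R\<inverse> = parcs G"
    using R(2) G.in_arcsD1 G.in_arcsD2 by auto
  define D where "D = \<lparr>pverts = pverts G, parcs = R\<rparr>"
  have RE: "u \<in> pverts G \<and> v \<in> pverts G \<and> u \<noteq> v" if "(u, v) \<in> R" for u v
    using RG that G.in_arcsD1 G.in_arcsD2 G.no_loops' by blast
  have "finite R"
    using RG G.pair_finite_arcs by (metis finite_Un)
  then have "pair_digraph D"
    by unfold_locales (auto simp: D_def G.pair_finite_verts dest: RE)
  then have "oriented_graph D"
    using R(1) unfolding oriented_graph_def D_def by auto
  moreover have "mk_symmetric (with_proj D) = G"
    using RG by (intro pair_pre_digraph.equality) (auto simp: D_def parcs_mk_symmetric_with_proj)
  ultimately have "contains_copy D Hvec"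
    using arrows unfolding arrows_def orientation_of_def by blast
  then obtain f where inj: "inj_on f (pverts Hvec)" and fV: "f ` pverts Hvec \<subseteq> pverts G"
    and fR: "\<And>x y. (x, y) \<in> parcs Hvec \<Longrightarrow> (f x, f y) \<in> R"
    by (rule contains_copyE) (auto simp: D_def)
  have sym_Hvec: "mk_symmetric (with_proj Hvec) = H"
    using assms(4) unfolding orientation_of_def by blast
  have verts: "pverts Hvec = pverts H"
    using sym_Hvec by auto
  have arcs: "parcs H = parcs Hvec \<union> (parcs Hvec)\<inverse>"
    using parcs_mk_symmetric_with_proj[of Hvec] sym_Hvec by simp
  \<comment> \<open>The null graph has minimum degree 0 by convention, so it is excluded.\<close>
  have "pverts H \<noteq> {}"
    using assms(3) unfolding min_degree_def by auto
  \<comment> \<open>Apply the balance condition to the vertex set of the copy; \<open>x\<close> is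
    the preimage of the vertex found, which plays the part of the last vertex of the copy.\<close>
  then obtain x where x: "x \<in> pverts H"
    and small: "card {u \<in> f ` pverts H. (f x, u) \<in> R} \<le> k"
      "card {u \<in> f ` pverts H. (u, f x) \<in> R} \<le> k"
    using deg[rule_format, of "f ` pverts H"] fV verts by auto
  have bound: "card S \<le> k"
    \<comment> \<open>Since \<open>f\<close> is injective, the bounds on neighbours of
      \<open>f x\<close> within the copy pull back to in- and out-neighbours of \<open>x\<close> in
      \<open>Hvec\<close>.\<close>
    if "S \<subseteq> pverts H" "f ` S \<subseteq> T" "T \<subseteq> f ` pverts H" "card T \<le> k" for S T
  proof -
    have "card S = card (f ` S)"
      using inj that(1) verts by (metis card_image inj_on_subset)
    also have "\<dots> \<le> card T"
      using that(2,3) H.pair_finite_verts by (meson card_mono finite_imageI finite_subset)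
    finally show ?thesis
      using that(4) by linarith
  qed
  have HvecV: "y \<in> pverts H \<and> z \<in> pverts H" if "(y, z) \<in> parcs Hvec" for y z
    using that arcs H.in_arcsD1 H.in_arcsD2 by blast
  have out_le: "card {y. (x, y) \<in> parcs Hvec} \<le> k"
    by (rule bound[OF _ _ _ small(1)]) (use HvecV fR in auto)
  have in_le: "card {y. (y, x) \<in> parcs Hvec} \<le> k"
    by (rule bound[OF _ _ _ small(2)]) (use HvecV fR in auto)
  have nbrs: "{y. (x, y) \<in> parcs H} = {y. (y, x) \<in> parcs Hvec} \<union> {y. (x, y) \<in> parcs Hvec}"
    using arcs by auto
  \<comment> \<open>As one of the two sets is empty, the bounds do not add up: \<open>x\<close> has
    at most \<open>k\<close> neighbours in \<open>H\<close>, one fewer than the minimum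
    degree.\<close>
  have "{y. (y, x) \<in> parcs Hvec} = {} \<or> {y. (x, y) \<in> parcs Hvec} = {}"
    using assms(5) x verts unfolding anti_directed_def by blast
  then have "card {y. (x, y) \<in> parcs H} \<le> k"
    using out_le in_le unfolding nbrs by (elim disjE) simp_all
  then show False
    using min_degree_le_card_neighbours[OF H.pair_finite_verts x] k by linarith
qed

end
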